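(* Let $X\neq\{0\}$ be a real Hilbert space. If $A:X\to X$ is a positive semidefinite and invertible linear operator, then $A$ is coercive (in particular, $A$ is positive definite). In fact, $$\langle Ax,x\rangle\geq \|A^{-1}\|^{-1}\|x\|^2\quad\text{for all } x\in X,$$ and $\|A^{-1}\|^{-1}$ is the optimal (largest possible) coercivity coefficient, i.e. the largest $\beta>0$ such that $\langle Ax,x\rangle\geq\beta\|x\|^2$ for all $x\in X$.
   Context: A linear operator $A:X\to X$ is positive semidefinite if it is continuous, self-adjoint ($A=A^*$) and $\langle Ax,x\rangle\geq 0$ for all $x\in X$; it is positive definite if it is continuous, self-adjoint and $\langle Ax,x\rangle>0$ for all $0\neq x\in X$. $A$ is coercive if there is $\beta>0$ (a coercivity coefficient) such that $\langle Ax,x\rangle\geq\beta\|x\|^2$ for all $x\in X$. $\|\cdot\|$ of an operator is the operator norm. *)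

theory Defs
  imports "HOL-Analysis.Analysis"
begin

text \<open>
  All notions below are meant for linear \<^term>\<open>A\<close>; linearity is assumed separately.

  The constant \<^const>\<open>adjoint\<close> is defined by choice. For a continuous linear operator on a Hilbert
  space the adjoint exists (by the Riesz representation theorem) and is unique, so there
  \<^term>\<open>adjoint A\<close> is the Hilbert space adjoint.
\<close>

definition positive_semidefinite :: "('a::real_inner \<Rightarrow> 'a) \<Rightarrow> bool" where
  "positive_semidefinite A \<longleftrightarrow>
     continuous_on UNIV A \<and> A = adjoint A \<and> (\<forall>x. A x \<bullet> x \<ge> 0)"

definition positive_definite :: "('a::real_inner \<Rightarrow> 'a) \<Rightarrow> bool" where
  "positive_definite A \<longleftrightarrow>
     continuous_on UNIV A \<and> A = adjoint A \<and> (\<forall>x. x \<noteq> 0 \<longrightarrow> A x \<bullet> x > 0)"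

definition coercivity_coefficient :: "('a::real_inner \<Rightarrow> 'a) \<Rightarrow> real \<Rightarrow> bool" where
  "coercivity_coefficient A \<beta> \<longleftrightarrow> \<beta> > 0 \<and> (\<forall>x. A x \<bullet> x \<ge> \<beta> * (norm x)\<^sup>2)"

definition coercive :: "('a::real_inner \<Rightarrow> 'a) \<Rightarrow> bool" where
  "coercive A \<longleftrightarrow> (\<exists>\<beta>. coercivity_coefficient A \<beta>)"

end

theory Submission
  imports Defs
begin

text \<open>
  Write \<open>B\<close> for \<open>inv A\<close>. It is symmetric and positive semidefinite because \<open>A\<close> is, so everything
  can be read off from \<open>B\<close>. If \<open>B\<close> is bounded with norm \<open>K\<close>, expanding
  \<open>0 \<le> B (K y - B y) \<bullet> (K y - B y)\<close> and estimating the term \<open>B (B y) \<bullet> B y\<close> by \<open>K (norm (B y))\<^sup>2\<close>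
  gives \<open>(norm (B y))\<^sup>2 \<le> K (B y \<bullet> y)\<close> (\<open>norm_power2_le_onorm_inner\<close>). With \<open>y = A x\<close> this is the
  coercivity estimate with coefficient \<open>1 / K\<close>. Conversely, coercivity with coefficient \<open>\<beta>\<close> and the
  Cauchy-Schwarz inequality give \<open>\<beta> norm x \<le> norm (A x)\<close>, which says \<open>K \<le> 1 / \<beta>\<close>; hence \<open>1 / K\<close>
  is optimal.

  Completeness of the space enters twice. The function \<open>adjoint\<close> is a choice among all formal
  adjoints, so \<open>A = adjoint A\<close> yields the symmetry of \<open>A\<close> only once some formal adjoint is known to
  exist; this is the Riesz representation theorem (\<open>adjoint_works_Hilbert\<close>). And \<open>B\<close> is
  bounded by the Hellinger-Toeplitz theorem, which rests on Baire's theorem and applies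
  because \<open>B\<close> is a symmetric linear operator defined on the whole space.
\<close>

lemma bounded_linear_if_bounded_on_ball:
  fixes f :: "'a::real_normed_vector \<Rightarrow> 'b::real_normed_vector"
  assumes "linear f" and "r > 0" and bound: "\<And>h. norm h < r \<Longrightarrow> norm (f h) \<le> C"
  shows "bounded_linear f"
proof -
  have "norm (f x) \<le> norm x * (C / (r / 2))" for x
  proof (cases "x = 0")
    case True
    then show ?thesis using linear_0[OF \<open>linear f\<close>] by simp
  next
    case False
    define t where "t = (r / 2) / norm x"
    have t: "t > 0" using False \<open>r > 0\<close> by (simp add: t_def)
    have "norm (t *\<^sub>R x) < r" using False \<open>r > 0\<close> by (simp add: t_def)
    from bound[OF this] have "t * norm (f x) \<le> C"
      using t by (simp add: linear_scale[OF \<open>linear f\<close>])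
    then show ?thesis using t False \<open>r > 0\<close> by (simp add: t_def field_simps)
  qed
  with \<open>linear f\<close> show ?thesis
    unfolding bounded_linear_def bounded_linear_axioms_def by blast
qed

lemma bounded_linear_if_continuous:
  fixes f :: "'a::real_normed_vector \<Rightarrow> 'b::real_normed_vector"
  assumes "linear f" and "continuous_on UNIV f"
  shows "bounded_linear f"
proof -
  obtain r where "r > 0" and r: "\<And>h. dist h 0 < r \<Longrightarrow> dist (f h) (f 0) < 1"
    using \<open>continuous_on UNIV f\<close> unfolding continuous_on_iff
    by (metis UNIV_I zero_less_one)
  have "norm (f h) \<le> 1" if "norm h < r" for h
    using r[of h] that linear_0[OF \<open>linear f\<close>] by simp
  with \<open>linear f\<close> \<open>r > 0\<close> show ?thesis
    by (rule bounded_linear_if_bounded_on_ball)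
qed

text \<open>
  The representing vector of \<open>f\<close> is the minimiser of the quadratic functional
  \<open>x \<bullet> x - 2 f x\<close>: were it represented by \<open>z\<close>, this functional would be the square of the distance
  from \<open>x\<close> to \<open>z\<close>, up to a constant. The parallelogram law makes minimising
  sequences Cauchy, and at the minimiser all directional derivatives vanish.
\<close>

lemma Riesz_representation:
  fixes f :: "'a::{real_inner, complete_space} \<Rightarrow> real"
  assumes f: "bounded_linear f"
  obtains z where "\<And>x. f x = x \<bullet> z"
proof -
  interpret bounded_linear f by (rule f)
  define g where "g x = x \<bullet> x - 2 * f x" for x
  define m where "m = (INF x. g x)"
  obtain K where K: "\<And>x. norm (f x) \<le> norm x * K" using bounded by blast
  have "- (K\<^sup>2) \<le> g x" for x
  proof -
    have "0 \<le> (norm x - K)\<^sup>2" by simp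
    also have "\<dots> = x \<bullet> x - 2 * (norm x * K) + K\<^sup>2"
      by (simp add: power2_diff power2_norm_eq_inner)
    finally show ?thesis using K[of x] by (simp add: g_def)
  qed
  then have bdd: "bdd_below (range g)" by (rule bdd_belowI2)
  have m_le: "m \<le> g x" for x unfolding m_def by (rule cINF_lower[OF bdd]) simp
  \<comment> \<open>Parallelogram law: the value at the midpoint of \<open>x\<close> and \<open>y\<close> is still at least \<open>m\<close>.\<close>
  have close: "(dist x y)\<^sup>2 \<le> 2 * (g x - m) + 2 * (g y - m)" for x y
  proof -
    have "2 * g x + 2 * g y - 4 * g ((1 / 2) *\<^sub>R (x + y)) = (dist x y)\<^sup>2"
      by (simp add: g_def add scaleR dist_norm power2_norm_eq_inner inner_diff inner_add
          inner_commute algebra_simps)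
    with m_le[of "(1 / 2) *\<^sub>R (x + y)"] show ?thesis by simp
  qed
  have "\<exists>x. g x < m + inverse (real (Suc n))" for n
  proof -
    have "m < m + inverse (real (Suc n))" by simp
    then show ?thesis unfolding m_def using cINF_less_iff[OF _ bdd] by blast
  qed
  then obtain X where X: "\<And>n. g (X n) < m + inverse (real (Suc n))" by metis
  have "Cauchy X"
  proof (rule metric_CauchyI)
    fix e :: real assume "e > 0"
    then obtain N where N: "inverse (real (Suc N)) < e\<^sup>2 / 4"
      using reals_Archimedean[of "e\<^sup>2 / 4"] by auto
    have small: "g (X i) - m < e\<^sup>2 / 4" if "i \<ge> N" for i
    proof -
      have "inverse (real (Suc i)) \<le> inverse (real (Suc N))"
        using that by (intro le_imp_inverse_le) auto
      then show ?thesis using X[of i] N by linarith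
    qed
    have "dist (X i) (X j) < e" if "i \<ge> N" "j \<ge> N" for i j
    proof (rule power2_less_imp_less)
      have "(dist (X i) (X j))\<^sup>2 \<le> 2 * (g (X i) - m) + 2 * (g (X j) - m)" by (rule close)
      also have "\<dots> < 2 * (e\<^sup>2 / 4) + 2 * (e\<^sup>2 / 4)"
        using small[OF that(1)] small[OF that(2)]
        by (intro add_strict_mono mult_strict_left_mono) simp_all
      also have "\<dots> = e\<^sup>2" by simp
      finally show "(dist (X i) (X j))\<^sup>2 < e\<^sup>2" .
    qed (use \<open>e > 0\<close> in simp)
    then show "\<exists>M. \<forall>i\<ge>M. \<forall>j\<ge>M. dist (X i) (X j) < e" by blast
  qed
  then obtain z where z: "X \<longlonglongrightarrow> z" by (auto simp: Cauchy_convergent_iff convergent_def)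
  have "(\<lambda>n. g (X n)) \<longlonglongrightarrow> g z"
    unfolding g_def by (intro tendsto_intros tendsto z)
  moreover have "(\<lambda>n. m + inverse (real (Suc n))) \<longlonglongrightarrow> m"
    using tendsto_add[OF tendsto_const LIMSEQ_inverse_real_of_nat] by simp
  ultimately have z_min: "g z \<le> m"
    by (rule LIMSEQ_le) (use X in \<open>auto intro: less_imp_le\<close>)
  have "f x = x \<bullet> z" for x
  proof (rule ccontr)
    assume "f x \<noteq> x \<bullet> z"
    define d where "d = f x - x \<bullet> z"
    have "d \<noteq> 0" using \<open>f x \<noteq> x \<bullet> z\<close> by (simp add: d_def)
    then have "x \<noteq> 0" using zero by (auto simp: d_def)
    then have xx: "x \<bullet> x > 0" by simp
    \<comment> \<open>The step along \<open>x\<close> that decreases \<open>g\<close> most.\<close>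
    define t where "t = d / (x \<bullet> x)"
    have "g (z + t *\<^sub>R x) = g z + (t * t * (x \<bullet> x) - 2 * t * d)"
      by (simp add: g_def d_def add scaleR inner_add inner_commute algebra_simps)
    also have "\<dots> = g z - d\<^sup>2 / (x \<bullet> x)"
      using xx by (simp add: t_def field_simps power2_eq_square)
    also have "\<dots> < g z" using xx \<open>d \<noteq> 0\<close> by simp
    finally show False using m_le[of "z + t *\<^sub>R x"] z_min by simp
  qed
  then show thesis using that by blast
qed

text \<open>
  The Riesz vectors of the functionals \<open>A x \<bullet> y\<close>, one for each \<open>y\<close>, form a formal adjoint, so the
  choice in the definition of \<open>adjoint\<close> is made from a nonempty set.
\<close>

lemma adjoint_works_Hilbert:
  fixes A :: "'a::{real_inner, complete_space} \<Rightarrow> 'b::real_inner"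
  assumes A: "bounded_linear A"
  shows "A x \<bullet> y = x \<bullet> adjoint A y"
proof -
  have "\<exists>z. \<forall>x. A x \<bullet> y = x \<bullet> z" for y
    using Riesz_representation[OF bounded_linear_compose[OF bounded_linear_inner_left A]]
    by metis
  then have "\<exists>A'. \<forall>x y. A x \<bullet> y = x \<bullet> A' y" by metis
  then show ?thesis unfolding adjoint_def by (rule someI2_ex) blast
qed

text \<open>
  Symmetry turns the sublevel sets of \<open>norm (B x)\<close> into intersections of the closed half-spaces
  \<open>x \<bullet> B y \<le> n norm y\<close>, so they are closed before anything is known about the continuity of \<open>B\<close>.
  They cover the space, so by Baire's theorem one of them contains a ball, and
  translating that ball to the origin bounds \<open>B\<close> near \<open>0\<close>.
\<close>

lemma Hellinger_Toeplitz:
  fixes B :: "'a::{real_inner, complete_space} \<Rightarrow> 'a"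
  assumes "linear B" and sym: "\<And>x y. B x \<bullet> y = x \<bullet> B y"
  shows "bounded_linear B"
proof -
  define F where "F n = {x. norm (B x) \<le> real n}" for n :: nat
  have F_eq: "F n = (\<Inter>y. {x. x \<bullet> B y \<le> real n * norm y})" for n
  proof (intro equalityI subsetI)
    fix x assume "x \<in> F n"
    then have "norm (B x) * norm y \<le> real n * norm y" for y
      by (simp add: F_def mult_right_mono)
    then have "x \<bullet> B y \<le> real n * norm y" for y
      using norm_cauchy_schwarz[of "B x" y] sym[of x y] by (metis order_trans)
    then show "x \<in> (\<Inter>y. {x. x \<bullet> B y \<le> real n * norm y})" by simp
  next
    fix x assume "x \<in> (\<Inter>y. {x. x \<bullet> B y \<le> real n * norm y})"
    then have "x \<bullet> B (B x) \<le> real n * norm (B x)" by blast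
    then have "norm (B x) * norm (B x) \<le> real n * norm (B x)"
      using sym[of x "B x"] by (simp add: power2_norm_eq_inner flip: power2_eq_square)
    then show "x \<in> F n" by (cases "B x = 0") (simp_all add: F_def)
  qed
  have closed_F: "closed (F n)" for n
    unfolding F_eq by (intro closed_INT ballI closed_Collect_le continuous_intros)
  have F_UNIV: "(\<Union>n. F n) = UNIV"
    using real_arch_simple by (auto simp: F_def)
  have "\<exists>n. interior (F n) \<noteq> {}"
    using Baire_category_alt[of "euclidean :: 'a topology" "range F"] closed_F F_UNIV
      completely_metrizable_space_euclidean[where 'a='a]
    by (auto simp flip: closed_closedin)
  then obtain n a r where "r > 0" and "ball a r \<subseteq> F n"
    by (metis mem_interior all_not_in_conv)
  have "norm (B h) \<le> 2 * real n" if "norm h < r" for h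
  proof -
    have "a + h \<in> F n" "a \<in> F n"
      using \<open>ball a r \<subseteq> F n\<close> \<open>r > 0\<close> that by (auto simp: dist_norm)
    then show ?thesis
      using norm_triangle_ineq4[of "B (a + h)" "B a"]
      by (simp add: F_def linear_add[OF \<open>linear B\<close>])
  qed
  with \<open>linear B\<close> \<open>r > 0\<close> show ?thesis
    by (rule bounded_linear_if_bounded_on_ball)
qed

text \<open>
  A reverse to the Cauchy-Schwarz inequality \<open>B y \<bullet> y \<le> norm (B y) * norm y\<close>: a nonnegative symmetric operator can make \<open>B y \<bullet> y\<close> small only by making \<open>B y\<close> small.
  The vector \<open>K y - B y\<close> used below minimises the form \<open>B v \<bullet> v\<close>, up to scaling, among the
  \<open>v = y - t B y\<close> when \<open>B (B y) \<bullet> B y\<close> is replaced by its upper bound \<open>K (norm (B y))\<^sup>2\<close>.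
\<close>

lemma norm_power2_le_onorm_inner:
  fixes B :: "'a::real_inner \<Rightarrow> 'a"
  assumes B: "bounded_linear B" and sym: "\<And>x y. B x \<bullet> y = x \<bullet> B y"
    and nonneg: "\<And>x. 0 \<le> B x \<bullet> x"
  shows "(norm (B y))\<^sup>2 \<le> onorm B * (B y \<bullet> y)"
proof (cases "onorm B = 0")
  case True
  then show ?thesis using onorm_eq_0[OF B] by simp
next
  case False
  define K where "K = onorm B"
  have K: "K > 0" using False onorm_pos_le[OF B] by (simp add: K_def)
  interpret bounded_linear B by (rule B)
  define u where "u = B y"
  have uu: "B u \<bullet> y = u \<bullet> u" using sym[of u y] by (simp add: u_def)
  have "B u \<bullet> u \<le> norm (B u) * norm u" by (rule norm_cauchy_schwarz)
  also have "\<dots> \<le> K * norm u * norm u"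
    unfolding K_def by (intro mult_right_mono onorm[OF B]) simp
  also have "\<dots> = K * (u \<bullet> u)" by (simp add: power2_norm_eq_inner[symmetric] power2_eq_square)
  finally have Bu: "B u \<bullet> u \<le> K * (u \<bullet> u)" .
  have "0 \<le> B (K *\<^sub>R y - u) \<bullet> (K *\<^sub>R y - u)" by (rule nonneg)
  also have "\<dots> = K * K * (u \<bullet> y) - 2 * K * (u \<bullet> u) + B u \<bullet> u"
    by (simp add: diff scaleR inner_diff uu flip: u_def) (simp add: algebra_simps)
  also have "\<dots> \<le> K * (K * (u \<bullet> y) - u \<bullet> u)"
    using Bu by (simp add: algebra_simps)
  finally show ?thesis
    using K by (simp add: zero_le_mult_iff power2_norm_eq_inner flip: K_def u_def)
qed

theorem lemma3p4:
  fixes A :: "'a::{real_inner, complete_space} \<Rightarrow> 'a"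
  assumes "(UNIV :: 'a set) \<noteq> {0}"
    and "linear A"
    and "positive_semidefinite A"
    and "bij A"
  shows "coercive A \<and> positive_definite A \<and>
    (\<forall>x. A x \<bullet> x \<ge> inverse (onorm (inv A)) * (norm x)\<^sup>2) \<and>
    coercivity_coefficient A (inverse (onorm (inv A))) \<and>
    (\<forall>\<beta>. coercivity_coefficient A \<beta> \<longrightarrow> \<beta> \<le> inverse (onorm (inv A)))"
proof -
  define B where "B = inv A"
  have AB [simp]: "A (B y) = y" and BA [simp]: "B (A x) = x" for x y
    using \<open>bij A\<close> by (simp_all add: B_def bij_is_surj bij_is_inj surj_f_inv_f)
  have cont: "continuous_on UNIV A" and self_adjoint: "A = adjoint A"
    and A_nonneg: "\<And>x. 0 \<le> A x \<bullet> x"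
    using \<open>positive_semidefinite A\<close> by (auto simp: positive_semidefinite_def)
  have A_sym: "A x \<bullet> y = x \<bullet> A y" for x y
    using adjoint_works_Hilbert[OF bounded_linear_if_continuous[OF \<open>linear A\<close> cont]]
      self_adjoint by metis
  have "linear B"
  proof (rule linearI)
    show "B (x + y) = B x + B y" for x y
      using BA[of "B x + B y"] by (simp add: linear_add[OF \<open>linear A\<close>])
    show "B (c *\<^sub>R x) = c *\<^sub>R B x" for c x
      using BA[of "c *\<^sub>R B x"] by (simp add: linear_scale[OF \<open>linear A\<close>])
  qed
  have B_sym: "B x \<bullet> y = x \<bullet> B y" for x y
    using A_sym[of "B x" "B y"] by simp
  have B: "bounded_linear B"
    using \<open>linear B\<close> B_sym by (rule Hellinger_Toeplitz)
  have B_nonneg: "0 \<le> B y \<bullet> y" for y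
    using A_nonneg[of "B y"] by (simp add: inner_commute)
  obtain e :: 'a where "e \<noteq> 0" using assms(1) by auto
  have "B (A e) \<noteq> 0" using \<open>e \<noteq> 0\<close> by simp
  then have K: "onorm B > 0" using onorm_pos_lt[OF B] by blast
  have bound: "inverse (onorm B) * (norm x)\<^sup>2 \<le> A x \<bullet> x" for x
    using norm_power2_le_onorm_inner[OF B B_sym B_nonneg, of "A x"] K
    by (simp add: inner_commute field_simps)
  have coeff: "coercivity_coefficient A (inverse (onorm B))"
    using K bound by (simp add: coercivity_coefficient_def)
  have "A x \<bullet> x > 0" if "x \<noteq> 0" for x
  proof -
    have "0 < inverse (onorm B) * (norm x)\<^sup>2" using K that by simp
    also have "\<dots> \<le> A x \<bullet> x" by (rule bound)
    finally show ?thesis .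
  qed
  then have pos_def: "positive_definite A"
    using cont self_adjoint by (simp add: positive_definite_def)
  have optimal: "\<beta> \<le> inverse (onorm B)" if "coercivity_coefficient A \<beta>" for \<beta>
  proof -
    have "\<beta> > 0" and coer: "\<And>x. \<beta> * (norm x)\<^sup>2 \<le> A x \<bullet> x"
      using that by (auto simp: coercivity_coefficient_def)
    have "norm (B y) \<le> inverse \<beta> * norm y" for y
    proof -
      have "\<beta> * norm (B y) * norm (B y) \<le> y \<bullet> B y"
        using coer[of "B y"] by (simp add: power2_eq_square)
      also have "\<dots> \<le> norm y * norm (B y)" by (rule norm_cauchy_schwarz)
      finally have "\<beta> * norm (B y) \<le> norm y"
        by (cases "B y = 0") (simp_all add: mult_le_cancel_right)
      then show ?thesis using \<open>\<beta> > 0\<close> by (simp add: field_simps)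
    qed
    then have "onorm B \<le> inverse \<beta>"
      using \<open>\<beta> > 0\<close> by (intro onorm_bound) auto
    then show ?thesis using K \<open>\<beta> > 0\<close> by (simp add: field_simps)
  qed
  show ?thesis
    using coeff pos_def bound optimal by (auto simp: coercive_def simp flip: B_def)
qed

end
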